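(* For any integer $\gamma \geq 0$, $\mathsf{Dias}_\gamma$ is a nontrivially rooted operad for the root map sending any word of $\mathsf{Dias}_\gamma$ to the position of its $0$.
   Context: Write $[\gamma] = \{1, \dots, \gamma\}$ (empty if $\gamma = 0$). A set-operad is a nonsymmetric operad in sets, described by partial compositions $\circ_i$ and a unit. $\mathsf{Dias}_\gamma$ is the set-operad generated by the two-letter words $0a$ and $a0$, $a \in [\gamma]$, inside the set-operad $\mathsf{T}\mathcal{M}_\gamma$ whose elements of arity $n \ge 1$ are all words of length $n$ on $\{0\} \cup [\gamma]$, with partial compositions $u \circ_i v := u_1 \dots u_{i-1}\,\max(u_i, v_1) \dots \max(u_i, v_m)\, u_{i+1} \dots u_n$ (for $u$ of length $n$, $v$ of length $m$, $1 \le i \le n$) and unit the word $0$. Every word of $\mathsf{Dias}_\gamma$ contains exactly one $0$. An operad $\mathcal{O}$ is rooted if there is a root map, that is, a map $\mathrm{root} : \mathcal{O}(n) \to \{1,\dots,n\}$, $n \geq 1$, such that for all $x \in \mathcal{O}(n)$, $y \in \mathcal{O}(m)$, $1 \le i \le n$: $\mathrm{root}(x \circ_i y) = \mathrm{root}(x) + m - 1$ if $i \leq \mathrm{root}(x) - 1$; $\mathrm{root}(x \circ_i y) = \mathrm{root}(x) + \mathrm{root}(y) - 1$ if $i = \mathrm{root}(x)$; and $\mathrm{root}(x \circ_i y) = \mathrm{root}(x)$ if $i \geq \mathrm{root}(x) + 1$. Any operad is rooted for the root maps $\mathrm{root}_{\mathrm{L}}$ and $\mathrm{root}_{\mathrm{R}}$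 sending every element of arity $n$ to $1$, respectively to $n$. An operad is nontrivially rooted if it can be endowed with a root map different from $\mathrm{root}_{\mathrm{L}}$ and $\mathrm{root}_{\mathrm{R}}$; it is nontrivially rooted for a given root map if that root map is different from these two.
   Formalization: Rootedness for the position of the 0 is stated for every γ ≥ 0, but nontriviality only for γ ≥ 1, since Dias_0 consists of the unit word 0 alone, where this root map equals both root_L and root_R. *)

theory Defs
  imports Main
begin

text \<open>
  A nonsymmetric set-operad is given by the disjoint union of its components: the component of
  arity \<open>n\<close> is the set of the elements \<open>x\<close> with \<open>arity P x = n\<close>. The values of the operations
  outside \<open>elems P\<close>, or at an index outside \<open>{1..arity P x}\<close>, are irrelevant.
\<close>

record 'a operad_data =
  elems :: "'a set"
  arity :: "'a \<Rightarrow> nat"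
  pcomp :: "'a \<Rightarrow> nat \<Rightarrow> 'a \<Rightarrow> 'a"
  op_unit :: "'a"

locale set_operad =
  fixes P :: "('a, 'b) operad_data_scheme"
  assumes arity_pos: "x \<in> elems P \<Longrightarrow> 1 \<le> arity P x"
    and pcomp_closed:
      "\<lbrakk>x \<in> elems P; y \<in> elems P; i \<in> {1..arity P x}\<rbrakk> \<Longrightarrow> pcomp P x i y \<in> elems P"
    and arity_pcomp:
      "\<lbrakk>x \<in> elems P; y \<in> elems P; i \<in> {1..arity P x}\<rbrakk>
        \<Longrightarrow> arity P (pcomp P x i y) = arity P x + arity P y - 1"
    and unit_closed: "op_unit P \<in> elems P"
    and arity_unit: "arity P (op_unit P) = 1"
    and unit_left: "x \<in> elems P \<Longrightarrow> pcomp P (op_unit P) 1 x = x"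
    and unit_right: "\<lbrakk>x \<in> elems P; i \<in> {1..arity P x}\<rbrakk> \<Longrightarrow> pcomp P x i (op_unit P) = x"
    and assoc_sequential:
      "\<lbrakk>x \<in> elems P; y \<in> elems P; z \<in> elems P; i \<in> {1..arity P x}; j \<in> {1..arity P y}\<rbrakk>
        \<Longrightarrow> pcomp P (pcomp P x i y) (i + j - 1) z = pcomp P x i (pcomp P y j z)"
    and assoc_parallel:
      "\<lbrakk>x \<in> elems P; y \<in> elems P; z \<in> elems P; 1 \<le> i; i < j; j \<le> arity P x\<rbrakk>
        \<Longrightarrow> pcomp P (pcomp P x i y) (j + arity P y - 1) z = pcomp P (pcomp P x j z) i y"

inductive_set generated_elems :: "('a, 'b) operad_data_scheme \<Rightarrow> 'a set \<Rightarrow> 'a set"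
  for P :: "('a, 'b) operad_data_scheme" and G :: "'a set" where
  gen_unit: "op_unit P \<in> generated_elems P G"
| gen_base: "g \<in> G \<Longrightarrow> g \<in> generated_elems P G"
| gen_pcomp: "\<lbrakk>x \<in> generated_elems P G; y \<in> generated_elems P G; i \<in> {1..arity P x}\<rbrakk>
    \<Longrightarrow> pcomp P x i y \<in> generated_elems P G"

definition generated_suboperad :: "'a operad_data \<Rightarrow> 'a set \<Rightarrow> 'a operad_data" where
  "generated_suboperad P G = P\<lparr>elems := generated_elems P G\<rparr>"

definition is_root_map :: "('a, 'b) operad_data_scheme \<Rightarrow> ('a \<Rightarrow> nat) \<Rightarrow> bool" where
  "is_root_map P root \<longleftrightarrow>
     (\<forall>x \<in> elems P. root x \<in> {1..arity P x}) \<and>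
     (\<forall>x \<in> elems P. \<forall>y \<in> elems P. \<forall>i \<in> {1..arity P x}.
        (i \<le> root x - 1 \<longrightarrow> root (pcomp P x i y) = root x + arity P y - 1) \<and>
        (i = root x \<longrightarrow> root (pcomp P x i y) = root x + root y - 1) \<and>
        (i \<ge> root x + 1 \<longrightarrow> root (pcomp P x i y) = root x))"

definition root_L :: "('a, 'b) operad_data_scheme \<Rightarrow> 'a \<Rightarrow> nat" where
  "root_L P x = 1"

definition root_R :: "('a, 'b) operad_data_scheme \<Rightarrow> 'a \<Rightarrow> nat" where
  "root_R P x = arity P x"

definition rooted_operad_for :: "('a, 'b) operad_data_scheme \<Rightarrow> ('a \<Rightarrow> nat) \<Rightarrow> bool" where
  "rooted_operad_for P root \<longleftrightarrow> set_operad P \<and> is_root_map P root"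

text \<open>
  Root maps are maps on \<open>elems P\<close>, so two of them are different when they differ at some
  element of \<open>P\<close>.
\<close>

definition nontrivially_rooted_operad_for ::
    "('a, 'b) operad_data_scheme \<Rightarrow> ('a \<Rightarrow> nat) \<Rightarrow> bool" where
  "nontrivially_rooted_operad_for P root \<longleftrightarrow>
     rooted_operad_for P root \<and>
     (\<exists>x \<in> elems P. root x \<noteq> root_L P x) \<and>
     (\<exists>x \<in> elems P. root x \<noteq> root_R P x)"

text \<open>Letters of words are numbered from 1 in operadic compositions, but from 0 by \<open>(!)\<close>.\<close>

definition word_pcomp :: "nat list \<Rightarrow> nat \<Rightarrow> nat list \<Rightarrow> nat list" where
  "word_pcomp u i v = take (i - 1) u @ map (max (u ! (i - 1))) v @ drop i u"

definition TM :: "nat \<Rightarrow> nat list operad_data" where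
  "TM \<gamma> = \<lparr>elems = {w. w \<noteq> [] \<and> set w \<subseteq> {0} \<union> {1..\<gamma>}},
           arity = length,
           pcomp = word_pcomp,
           op_unit = [0]\<rparr>"

definition Dias :: "nat \<Rightarrow> nat list operad_data" where
  "Dias \<gamma> = generated_suboperad (TM \<gamma>)
     ({[0, a] | a. a \<in> {1..\<gamma>}} \<union> {[a, 0] | a. a \<in> {1..\<gamma>}})"

definition zero_position :: "nat list \<Rightarrow> nat" where
  "zero_position w = (THE i. i \<in> {1..length w} \<and> w ! (i - 1) = 0)"

text \<open>
  \<open>Dias 0\<close> has no generator: it consists of its unit only, on which all root maps coincide with
  \<open>root_L\<close> and \<open>root_R\<close>.
\<close>

lemma elems_Dias_0: "elems (Dias 0) = {[0]}"
proof -
  have "w = [0]" if "w \<in> generated_elems (TM 0) {}" for w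
    using that by induction (auto simp: TM_def word_pcomp_def)
  moreover have "[0] \<in> generated_elems (TM 0) {}"
    using gen_unit[of "TM 0" "{}"] by (simp add: TM_def)
  ultimately have "generated_elems (TM 0) {} = {[0]}"
    by blast
  then show ?thesis
    by (simp add: Dias_def generated_suboperad_def)
qed

lemma Dias_0_not_nontrivially_rooted: "\<not> nontrivially_rooted_operad_for (Dias 0) root"
proof
  assume nontriv: "nontrivially_rooted_operad_for (Dias 0) root"
  have "arity (Dias 0) [0] = 1"
    by (simp add: Dias_def generated_suboperad_def TM_def)
  with nontriv show False
    by (auto simp: nontrivially_rooted_operad_for_def rooted_operad_for_def is_root_map_def
        root_L_def elems_Dias_0)
qed

end

theory Submission
  imports Defs
begin

text \<open>Composition takes maxima with the letter at which a word is inserted. At a nonzero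
  letter every inserted letter becomes nonzero; at a zero letter the word is copied unchanged. So
  words with exactly one 0 are closed under composition, and the surviving 0 shifts, is replaced by
  that of the inserted word, or stays put, according to whether the insertion is left of it, at it
  or right of it: these are the root axioms (\<open>zero_position_word_pcomp\<close>). By induction
  on generation all of \<open>Dias \<gamma>\<close> has this form (\<open>one_zero_Dias\<close>).
  The operad axioms hold in \<open>TM \<gamma>\<close> because max is associative with neutral
  element 0, and pass to suboperads. For \<gamma> \<ge> 1 the generators 10 and 01 rule out
  \<open>root_L\<close> and \<open>root_R\<close>; \<open>Dias 0\<close> has only its unit, so there
  nontriviality fails.\<close>

lemma generated_elems_subset:
  assumes "set_operad P" "G \<subseteq> elems P"
  shows "generated_elems P G \<subseteq> elems P"
proof
  fix x
  assume "x \<in> generated_elems P G"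
  then show "x \<in> elems P"
    using assms by induction (auto intro: set_operad.unit_closed set_operad.pcomp_closed)
qed

text \<open>The axioms are universal statements, so they restrict to any subset that contains the
  unit and is closed under composition.\<close>

lemma set_operad_generated_suboperad:
  assumes P: "set_operad P" and G: "G \<subseteq> elems P"
  shows "set_operad (generated_suboperad P G)"
proof -
  interpret set_operad P by (rule P)
  have sub: "x \<in> elems P" if "x \<in> generated_elems P G" for x
    using generated_elems_subset[OF P G] that by blast
  show ?thesis
    by unfold_locales
      (auto simp: generated_suboperad_def gen_unit gen_pcomp sub arity_pos arity_pcomp arity_unit
        unit_left unit_right assoc_sequential assoc_parallel simp del: One_nat_def)
qed

text \<open>Replaces index arithmetic by factorizations of words, on which
  \<open>word_pcomp_split\<close> computes compositions.\<close>

lemma split_at_position: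
  assumes "i \<in> {1..length u}"
  obtains a c b where "u = a @ c # b" "i = Suc (length a)"
proof
  show "u = take (i - 1) u @ u ! (i - 1) # drop i u"
    using assms id_take_nth_drop[of "i - 1" u] by fastforce
  show "i = Suc (length (take (i - 1) u))"
    using assms by auto
qed

lemma word_pcomp_split:
  "i = Suc (length a) \<Longrightarrow> word_pcomp (a @ c # b) i v = a @ map (max c) v @ b"
  by (simp add: word_pcomp_def)

lemma word_pcomp_assoc_sequential:
  assumes "i \<in> {1..length x}" "j \<in> {1..length y}"
  shows "word_pcomp (word_pcomp x i y) (i + j - 1) z = word_pcomp x i (word_pcomp y j z)"
proof -
  obtain a c b where x: "x = a @ c # b" "i = Suc (length a)"
    using assms(1) by (rule split_at_position)
  obtain d e f where y: "y = d @ e # f" "j = Suc (length d)"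
    using assms(2) by (rule split_at_position)
  \<comment> \<open>The word is regrouped around its letter number \<open>i + j - 1\<close>, which
    is \<open>max c e\<close>; associativity of max does the rest.\<close>
  have "word_pcomp ((a @ map (max c) d) @ max c e # (map (max c) f @ b)) (i + j - 1) z =
      (a @ map (max c) d) @ map (max (max c e)) z @ (map (max c) f @ b)"
    by (rule word_pcomp_split) (simp add: x y)
  then show ?thesis
    by (simp add: x y word_pcomp_split max.assoc comp_def)
qed

lemma word_pcomp_assoc_parallel:
  assumes "1 \<le> i" "i < j" "j \<le> length x"
  shows "word_pcomp (word_pcomp x i y) (j + length y - 1) z = word_pcomp (word_pcomp x j z) i y"
proof -
  obtain t e f where t: "x = t @ e # f" "j = Suc (length t)"
    using assms by (auto intro: split_at_position[of j x])
  \<comment> \<open>As \<open>i < j\<close>, the letter number \<open>i\<close> lies in the prefix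
    \<open>t\<close>, so the two insertions do not interact.\<close>
  obtain a c d where a: "t = a @ c # d" "i = Suc (length a)"
    using assms t by (auto intro: split_at_position[of i t])
  have "word_pcomp ((a @ map (max c) y @ d) @ e # f) (j + length y - 1) z =
      (a @ map (max c) y @ d) @ map (max e) z @ f"
    by (rule word_pcomp_split) (simp add: t a)
  moreover have "word_pcomp ((a @ c # d) @ e # f) j z = (a @ c # d) @ map (max e) z @ f"
    by (rule word_pcomp_split) (simp add: t a)
  ultimately show ?thesis
    by (simp add: t(1) a word_pcomp_split)
qed

lemma set_operad_TM: "set_operad (TM \<gamma>)"
proof
  fix x y i
  assume x: "x \<in> elems (TM \<gamma>)" and y: "y \<in> elems (TM \<gamma>)" and i: "i \<in> {1..arity (TM \<gamma>) x}"
  obtain a c b where s: "x = a @ c # b" "i = Suc (length a)"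
    using i by (auto simp: TM_def intro: split_at_position[of i x])
  show "pcomp (TM \<gamma>) x i y \<in> elems (TM \<gamma>)"
    using x y by (auto simp: TM_def s word_pcomp_split max_def)
  show "arity (TM \<gamma>) (pcomp (TM \<gamma>) x i y) = arity (TM \<gamma>) x + arity (TM \<gamma>) y - 1"
    by (simp add: TM_def s word_pcomp_split)
next
  fix x i
  assume "i \<in> {1..arity (TM \<gamma>) x}"
  then obtain a c b where "x = a @ c # b" "i = Suc (length a)"
    by (auto simp: TM_def intro: split_at_position[of i x])
  then show "pcomp (TM \<gamma>) x i (op_unit (TM \<gamma>)) = x"
    by (simp add: TM_def word_pcomp_split)
next
  fix x
  show "pcomp (TM \<gamma>) (op_unit (TM \<gamma>)) 1 x = x"
    by (simp add: TM_def word_pcomp_def map_idI)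
qed (auto simp: TM_def Suc_le_eq word_pcomp_assoc_sequential[simplified]
    word_pcomp_assoc_parallel[simplified])

lemma set_operad_Dias: "set_operad (Dias \<gamma>)"
  unfolding Dias_def
  by (rule set_operad_generated_suboperad[OF set_operad_TM]) (auto simp: TM_def)

text \<open>Uniqueness of the 0 is encoded as a factorization, so that its position can be read off
  as the length of the prefix plus one.\<close>

definition one_zero :: "nat list \<Rightarrow> bool" where
  "one_zero w \<longleftrightarrow> (\<exists>a b. w = a @ 0 # b \<and> 0 \<notin> set a \<and> 0 \<notin> set b)"

lemma one_zeroI: "w = a @ 0 # b \<Longrightarrow> 0 \<notin> set a \<Longrightarrow> 0 \<notin> set b \<Longrightarrow> one_zero w"
  by (auto simp: one_zero_def)

lemma zero_position_eq:
  assumes "w = a @ 0 # b" "0 \<notin> set a" "0 \<notin> set b"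
  shows "zero_position w = Suc (length a)"
  unfolding zero_position_def
proof (rule the_equality)
  fix i
  assume "i \<in> {1..length w} \<and> w ! (i - 1) = 0"
  then have "i \<in> {1..length w}" "w ! (i - 1) = 0"
    by auto
  then obtain c d where w: "w = c @ 0 # d" "i = Suc (length c)"
    by (metis split_at_position diff_Suc_1 nth_append_length)
  \<comment> \<open>Since \<open>a\<close> and \<open>b\<close> contain no 0, two factorizations of
    \<open>w\<close> around a 0 coincide.\<close>
  with assms have "a = c"
    by (metis append_Cons_eq_iff in_set_conv_decomp)
  with w show "i = Suc (length a)"
    by simp
qed (simp add: assms)

text \<open>
  Inserting a word at a nonzero letter produces no zero, because of the maximum with that letter;
  inserting it at the zero letter leaves it unchanged.
\<close>

lemma
  assumes "one_zero x" "one_zero y" "i \<in> {1..length x}"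
  shows one_zero_word_pcomp: "one_zero (word_pcomp x i y)"
    and zero_position_word_pcomp:
      "zero_position (word_pcomp x i y) =
        (if i < zero_position x then zero_position x + length y - 1
         else if i = zero_position x then zero_position x + zero_position y - 1
         else zero_position x)"
proof -
  obtain a b where x: "x = a @ 0 # b" "0 \<notin> set a" "0 \<notin> set b"
    using assms(1) by (auto simp: one_zero_def)
  note zx = zero_position_eq[OF x]
  \<comment> \<open>One factorization of the composite, with the prefix length controlled, yields
    both claims.\<close>
  have "\<exists>c d. word_pcomp x i y = c @ 0 # d \<and> 0 \<notin> set c \<and> 0 \<notin> set d \<and>
      Suc (length c) =
        (if i < zero_position x then zero_position x + length y - 1
         else if i = zero_position x then zero_position x + zero_position y - 1
         else zero_position x)"
  proof (cases i "zero_position x" rule: linorder_cases)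
    case less
    then have "i \<in> {1..length a}"
      using assms(3) zx by simp
    then obtain c e d where a: "a = c @ e # d" "i = Suc (length c)"
      by (rule split_at_position)
    have "word_pcomp x i y = (c @ map (max e) y @ d) @ 0 # b"
      by (simp add: x(1) a word_pcomp_split)
    then show ?thesis
      using x(2,3) a less zx by (intro exI[of _ "c @ map (max e) y @ d"] exI[of _ b]) auto
  next
    case equal
    obtain c d where y: "y = c @ 0 # d" "0 \<notin> set c" "0 \<notin> set d"
      using assms(2) by (auto simp: one_zero_def)
    have "word_pcomp x i y = (a @ c) @ 0 # (d @ b)"
      using equal zx by (simp add: x(1) y(1) word_pcomp_split map_idI)
    then show ?thesis
      using x(2,3) y(2,3) equal zx zero_position_eq[OF y]
      by (intro exI[of _ "a @ c"] exI[of _ "d @ b"]) auto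
  next
    case greater
    \<comment> \<open>The insertion happens right of the 0, at this position inside the suffix
      \<open>b\<close>.\<close>
    then have "i - Suc (length a) \<in> {1..length b}"
      using assms(3) zx x(1) by auto
    then obtain c e d where b: "b = c @ e # d" "i - Suc (length a) = Suc (length c)"
      by (rule split_at_position)
    have "word_pcomp ((a @ 0 # c) @ e # d) i y = (a @ 0 # c) @ map (max e) y @ d"
      by (rule word_pcomp_split) (use b(2) in simp)
    then show ?thesis
      using x b(1) greater zx
      by (intro exI[of _ a] exI[of _ "c @ map (max e) y @ d"]) auto
  qed
  then obtain c d where cd: "word_pcomp x i y = c @ 0 # d" "0 \<notin> set c" "0 \<notin> set d"
    and len: "Suc (length c) =
        (if i < zero_position x then zero_position x + length y - 1
         else if i = zero_position x then zero_position x + zero_position y - 1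
         else zero_position x)"
    by blast
  show "one_zero (word_pcomp x i y)"
    using cd by (rule one_zeroI)
  show "zero_position (word_pcomp x i y) =
        (if i < zero_position x then zero_position x + length y - 1
         else if i = zero_position x then zero_position x + zero_position y - 1
         else zero_position x)"
    using zero_position_eq[OF cd] len by simp
qed

text \<open>The generators qualify because their other letter is at least 1; compositions preserve
  the property.\<close>

lemma one_zero_Dias:
  assumes "w \<in> elems (Dias \<gamma>)"
  shows "one_zero w"
proof -
  have "w \<in> generated_elems (TM \<gamma>) ({[0, a] | a. a \<in> {1..\<gamma>}} \<union> {[a, 0] | a. a \<in> {1..\<gamma>}})"
    using assms by (simp add: Dias_def generated_suboperad_def)
  then show ?thesis
  proof induction
    case gen_unit
    show ?case
      by (rule one_zeroI[of _ "[]" "[]"]) (auto simp: TM_def)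
  next
    case (gen_base g)
    then consider a where "g = [] @ 0 # [a]" "a \<ge> 1" | a where "g = [a] @ 0 # []" "a \<ge> 1"
      by auto
    then show ?case
      by cases (auto intro: one_zeroI[of _ "[]"] one_zeroI[of _ "[_]"])
  next
    case (gen_pcomp x y i)
    then show ?case
      by (simp add: TM_def one_zero_word_pcomp)
  qed
qed

lemma zero_position_bounds:
  assumes "one_zero w"
  shows "zero_position w \<in> {1..length w}"
  using assms by (auto simp: one_zero_def zero_position_eq)

lemma is_root_map_zero_position: "is_root_map (Dias \<gamma>) zero_position"
proof -
  have [simp]: "arity (Dias \<gamma>) = length" "pcomp (Dias \<gamma>) = word_pcomp"
    by (simp_all add: Dias_def generated_suboperad_def TM_def)
  show ?thesis
    unfolding is_root_map_def
    \<comment> \<open>Once membership is traded for \<open>one_zero\<close>, the root axioms are the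
      three branches of \<open>zero_position_word_pcomp\<close>.\<close>
    using zero_position_bounds
    by (auto simp: zero_position_word_pcomp dest!: one_zero_Dias) fastforce+
qed

theorem proposition2p3p4:
  fixes \<gamma> :: nat
  shows "rooted_operad_for (Dias \<gamma>) zero_position \<and>
    (\<gamma> \<ge> 1 \<longrightarrow> nontrivially_rooted_operad_for (Dias \<gamma>) zero_position)"
proof -
  have rooted: "rooted_operad_for (Dias \<gamma>) zero_position"
    by (simp add: rooted_operad_for_def set_operad_Dias is_root_map_zero_position)
  moreover have "nontrivially_rooted_operad_for (Dias \<gamma>) zero_position" if "\<gamma> \<ge> 1"
  proof -
    \<comment> \<open>These words are generators since 1 is an available letter.\<close>
    have "[0, 1] \<in> elems (Dias \<gamma>)" "[1, 0] \<in> elems (Dias \<gamma>)"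
      using that by (auto simp: Dias_def generated_suboperad_def intro!: gen_base)
    moreover have "zero_position [1, 0] \<noteq> root_L (Dias \<gamma>) [1, 0]"
      using zero_position_eq[of "[1, 0]" "[1]" "[]"] by (simp add: root_L_def)
    moreover have "zero_position [0, 1] \<noteq> root_R (Dias \<gamma>) [0, 1]"
      using zero_position_eq[of "[0, 1]" "[]" "[1]"]
      by (simp add: root_R_def Dias_def generated_suboperad_def TM_def)
    ultimately show ?thesis
      using rooted unfolding nontrivially_rooted_operad_for_def by blast
  qed
  ultimately show ?thesis
    by blast
qed

end
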